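(* Let $\Gamma=(V(\Gamma),E(\Gamma),w_{\Gamma})$ be a weighted multigraph with all weights equal to $0$, $|V(\Gamma)|\ge 2$, and no vertices of degree $0$. Then $$\operatorname{gap}^{*}(\Gamma)=\max\Bigl\{0,\max_{v\in V(\Gamma)}\{\operatorname{gap}^{*}(\Gamma(v))-1\}\Bigr\}.$$
   Context: All graphs and multigraphs are finite and undirected. A graph $G=(V(G),E(G))$ has no multiple edges but may have loops. For nonempty $\mathcal K,\mathcal L\subseteq V(G)$ (possibly intersecting), the set-join $\mathcal K\vee\mathcal L$ is the graph on $V(G)$ with edges $\{i,j\}$, $i\in\mathcal K$, $j\in\mathcal L$. A set-join cover of $G$ is $\mathscr C=\{\mathcal K_i\vee\mathcal L_i: i\in[t]\}$ with $E(G)=\bigcup_i E(\mathcal K_i\vee\mathcal L_i)$; its component set is $V(\mathscr C)=\{\mathcal K_i\}_i\cup\{\mathcal L_i\}_i$. The SNT-rank is $\mathrm{st}_+(G)=\min|V(\mathscr C)|$ over all set-join covers of $G$ (the empty cover is used for an edgeless graph), and $\operatorname{gap}(G)=|V(G)|-\mathrm{st}_+(G)$; the graph with no vertices has gap $0$. Multigraphs may have parallel edges and several loops at a vertex; a vertex incident to $s$ loops and $t$ non-loop edges has degree $t+2s$. $\Gamma(v)$ is obtained from $\Gamma$ by deleting the vertex $v$ and all edges incident to it. For a multigraph $\Gamma$ with edge weights in $\{0,1\}$, $\zeta(\Gamma)$ is the simple loopless graph obtained from $\Gamma$ by replacing each weight-$0$ edge or loop $\{u,v\}$ (possibly $u=v$)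 by a path $u-x_1-x_2-v$, each weight-$1$ non-loop edge $\{u,v\}$ by a path $u-x_1-x_2-x_3-v$, and each weight-$1$ loop at $u$ by a closed path $u-x_1-\cdots-x_5-u$; all $x_i$ are new distinct vertices of degree $2$. Define $\operatorname{gap}^*(\Gamma)=\operatorname{gap}(\zeta(\Gamma))$. *)

theory Defs
  imports Main
begin

section \<open>Graphs with loops, set-join covers, SNT-rank and gap\<close>

text \<open>An edge is the set of its end-vertices, so a loop is a singleton.\<close>

record 'a graph =
  verts :: "'a set"
  edges :: "'a set set"

definition wf_graph :: "'a graph \<Rightarrow> bool" where
  "wf_graph G \<longleftrightarrow> finite (verts G) \<and>
     (\<forall>e\<in>edges G. \<exists>i\<in>verts G. \<exists>j\<in>verts G. e = {i, j})"

definition set_join_edges :: "'a set \<Rightarrow> 'a set \<Rightarrow> 'a set set" where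
  "set_join_edges K L = {{i, j} | i j. i \<in> K \<and> j \<in> L}"

text \<open>A cover is represented by the finite set of pairs \<open>(K\<^sub>i, L\<^sub>i)\<close>. All components
  are nonempty, so the empty set is the only cover of an edgeless graph.\<close>

definition set_join_cover :: "'a graph \<Rightarrow> ('a set \<times> 'a set) set \<Rightarrow> bool" where
  "set_join_cover G C \<longleftrightarrow> finite C \<and>
     (\<forall>(K, L)\<in>C. K \<noteq> {} \<and> L \<noteq> {} \<and> K \<subseteq> verts G \<and> L \<subseteq> verts G) \<and>
     edges G = (\<Union>(K, L)\<in>C. set_join_edges K L)"

definition components :: "('a set \<times> 'a set) set \<Rightarrow> 'a set set" where
  "components C = fst ` C \<union> snd ` C"

definition snt_rank :: "'a graph \<Rightarrow> nat" where
  "snt_rank G = (LEAST k. \<exists>C. set_join_cover G C \<and> card (components C) = k)"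

text \<open>Integer-valued, so that no subtraction is truncated.\<close>

definition gap :: "'a graph \<Rightarrow> int" where
  "gap G = int (card (verts G)) - int (snt_rank G)"

text \<open>The minimum is attained: the joins \<open>{i} \<or> {j}\<close> over all edges form a cover.\<close>

lemma ex_set_join_cover:
  assumes "wf_graph G"
  shows "\<exists>C. set_join_cover G C"
proof
  let ?C = "{({i}, {j}) | i j. i \<in> verts G \<and> j \<in> verts G \<and> {i, j} \<in> edges G}"
  have "?C \<subseteq> (\<lambda>(i, j). ({i}, {j})) ` (verts G \<times> verts G)" by auto
  then have "finite ?C"
    by (rule finite_subset) (use assms in \<open>auto simp: wf_graph_def\<close>)
  moreover have "edges G = (\<Union>(K, L)\<in>?C. set_join_edges K L)"
  proof (intro equalityI subsetI)
    fix e assume e: "e \<in> edges G"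
    then obtain i j where ij: "i \<in> verts G" "j \<in> verts G" "e = {i, j}"
      using assms unfolding wf_graph_def by blast
    then have "({i}, {j}) \<in> ?C" using e by blast
    moreover have "e \<in> set_join_edges {i} {j}" using ij unfolding set_join_edges_def by blast
    ultimately show "e \<in> (\<Union>(K, L)\<in>?C. set_join_edges K L)" by blast
  next
    fix e assume "e \<in> (\<Union>(K, L)\<in>?C. set_join_edges K L)"
    then show "e \<in> edges G" unfolding set_join_edges_def by auto
  qed
  moreover have "\<forall>(K, L)\<in>?C. K \<noteq> {} \<and> L \<noteq> {} \<and> K \<subseteq> verts G \<and> L \<subseteq> verts G"
    by auto
  ultimately show "set_join_cover G ?C"
    unfolding set_join_cover_def by (intro conjI)
qed

section \<open>Weighted multigraphs\<close>

text \<open>Edges have their own identity, which allows parallel edges and several loops at a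
  vertex; \<open>ends e\<close> is the set of end-vertices of \<open>e\<close>, a singleton if \<open>e\<close> is a loop.\<close>

record ('v, 'e) multigraph =
  mverts :: "'v set"
  medges :: "'e set"
  ends :: "'e \<Rightarrow> 'v set"
  weight :: "'e \<Rightarrow> nat"

definition wf_multigraph :: "('v, 'e) multigraph \<Rightarrow> bool" where
  "wf_multigraph \<Gamma> \<longleftrightarrow> finite (mverts \<Gamma>) \<and> finite (medges \<Gamma>) \<and>
     (\<forall>e\<in>medges \<Gamma>. (\<exists>u\<in>mverts \<Gamma>. \<exists>v\<in>mverts \<Gamma>. ends \<Gamma> e = {u, v}) \<and>
                   weight \<Gamma> e \<in> {0, 1})"

definition mdegree :: "('v, 'e) multigraph \<Rightarrow> 'v \<Rightarrow> nat" where
  "mdegree \<Gamma> v = card {e \<in> medges \<Gamma>. v \<in> ends \<Gamma> e \<and> ends \<Gamma> e \<noteq> {v}}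
                 + 2 * card {e \<in> medges \<Gamma>. ends \<Gamma> e = {v}}"

definition delete_vertex :: "('v, 'e) multigraph \<Rightarrow> 'v \<Rightarrow> ('v, 'e) multigraph" where
  "delete_vertex \<Gamma> v =
     \<Gamma>\<lparr>mverts := mverts \<Gamma> - {v}, medges := {e \<in> medges \<Gamma>. v \<notin> ends \<Gamma> e}\<rparr>"

section \<open>The graph \<open>\<zeta>(\<Gamma>)\<close>\<close>

text \<open>\<open>Orig v\<close> is the copy of a vertex \<open>v\<close> of the multigraph, \<open>Sub e i\<close> is the \<open>i\<close>-th new
  vertex on the path replacing \<open>e\<close>.\<close>

datatype ('v, 'e) zvertex = Orig 'v | Sub 'e nat

definition is_loop :: "('v, 'e) multigraph \<Rightarrow> 'e \<Rightarrow> bool" where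
  "is_loop \<Gamma> e \<longleftrightarrow> (\<exists>u. ends \<Gamma> e = {u})"

definition num_new :: "('v, 'e) multigraph \<Rightarrow> 'e \<Rightarrow> nat" where
  "num_new \<Gamma> e = (if weight \<Gamma> e = 0 then 2 else if is_loop \<Gamma> e then 5 else 3)"

text \<open>To number the new vertices on the path, one of the two traversal directions is chosen;
  \<open>\<zeta>(\<Gamma>)\<close> does not depend on it up to isomorphism.\<close>

definition orient :: "'v set \<Rightarrow> 'v \<times> 'v" where
  "orient A = (SOME p. A = {fst p, snd p})"

definition zpath :: "('v, 'e) multigraph \<Rightarrow> 'e \<Rightarrow> ('v, 'e) zvertex list" where
  "zpath \<Gamma> e = [Orig (fst (orient (ends \<Gamma> e)))]
     @ map (Sub e) [1..<Suc (num_new \<Gamma> e)] @ [Orig (snd (orient (ends \<Gamma> e)))]"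

definition zeta :: "('v, 'e) multigraph \<Rightarrow> ('v, 'e) zvertex graph" where
  "zeta \<Gamma> = \<lparr>
     verts = Orig ` mverts \<Gamma> \<union> {Sub e i | e i. e \<in> medges \<Gamma> \<and> i \<in> {1..num_new \<Gamma> e}},
     edges = {{zpath \<Gamma> e ! i, zpath \<Gamma> e ! Suc i} | e i.
                e \<in> medges \<Gamma> \<and> Suc i < length (zpath \<Gamma> e)}\<rparr>"

definition gap_star :: "('v, 'e) multigraph \<Rightarrow> int" where
  "gap_star \<Gamma> = gap (zeta \<Gamma>)"

lemma orient_ends:
  assumes "wf_multigraph \<Gamma>" "e \<in> medges \<Gamma>"
  shows "ends \<Gamma> e = {fst (orient (ends \<Gamma> e)), snd (orient (ends \<Gamma> e))}"
proof -
  from assms obtain u v where "ends \<Gamma> e = {fst (u, v), snd (u, v)}"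
    unfolding wf_multigraph_def by auto
  then show ?thesis unfolding orient_def by (rule someI)
qed

lemma wf_graph_zeta:
  assumes wf: "wf_multigraph \<Gamma>"
  shows "wf_graph (zeta \<Gamma>)"
proof -
  have "verts (zeta \<Gamma>) = Orig ` mverts \<Gamma> \<union> (\<Union>e\<in>medges \<Gamma>. Sub e ` {1..num_new \<Gamma> e})"
    unfolding zeta_def by auto
  then have fin: "finite (verts (zeta \<Gamma>))"
    using wf by (simp add: wf_multigraph_def)
  have path: "set (zpath \<Gamma> e) \<subseteq> verts (zeta \<Gamma>)" if e: "e \<in> medges \<Gamma>" for e
  proof -
    from wf e obtain u v where uv: "u \<in> mverts \<Gamma>" "v \<in> mverts \<Gamma>" "ends \<Gamma> e = {u, v}"
      unfolding wf_multigraph_def by blast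
    define p where "p = orient (ends \<Gamma> e)"
    have "{u, v} = {fst p, snd p}"
      using orient_ends[OF wf e] uv(3) by (simp only: p_def)
    then have "fst p \<in> mverts \<Gamma>" "snd p \<in> mverts \<Gamma>"
      using uv(1,2) by auto
    then have "fst (orient (ends \<Gamma> e)) \<in> mverts \<Gamma>" "snd (orient (ends \<Gamma> e)) \<in> mverts \<Gamma>"
      by (simp_all only: p_def)
    then show ?thesis using e unfolding zpath_def zeta_def by auto
  qed
  have "\<exists>i\<in>verts (zeta \<Gamma>). \<exists>j\<in>verts (zeta \<Gamma>). d = {i, j}" if d: "d \<in> edges (zeta \<Gamma>)" for d
  proof -
    from d obtain e i where ei: "d = {zpath \<Gamma> e ! i, zpath \<Gamma> e ! Suc i}" "e \<in> medges \<Gamma>"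
      "Suc i < length (zpath \<Gamma> e)" unfolding zeta_def by auto
    have "zpath \<Gamma> e ! i \<in> verts (zeta \<Gamma>)" "zpath \<Gamma> e ! Suc i \<in> verts (zeta \<Gamma>)"
      using path[OF ei(2)] nth_mem[OF ei(3)] nth_mem[OF Suc_lessD[OF ei(3)]] by auto
    with ei(1) show ?thesis by (intro bexI)
  qed
  with fin show ?thesis unfolding wf_graph_def by blast
qed

end

theory Submission
  imports Defs
begin

text \<open>Suppose that any two vertices of a graph have at most one common neighbour, so that
  every set-join in it is a star. If \<open>M\<close> is the set of
  vertices whose singleton is not a component of a cover, then every edge at \<open>M\<close> lies in a star
  whose centre is outside \<open>M\<close> and whose leaves form a non-singleton component, and a non-singleton
  component determines the centre. Hence the gap of such a graph is the maximum of
  \<open>|M| - |N(M)|\<close> over the independent sets \<open>M\<close>.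

  For weights \<open>0\<close> the graph \<open>\<zeta>(\<Gamma>)\<close> is of this kind. An independent set of \<open>\<zeta>(\<Gamma>(v))\<close> is extended
  by the neighbours of \<open>v\<close> on the non-loop edges, which costs only the vertex \<open>v\<close>. Conversely, if
  \<open>N(M)\<close> contains an original vertex \<open>v\<close>, then restricting \<open>M\<close> to \<open>\<zeta>(\<Gamma>(v))\<close> gains at least one,
  because the partner of a new vertex in \<open>M\<close> lies in \<open>N(M)\<close>; and if \<open>N(M)\<close> contains no original
  vertex, then \<open>M\<close> consists of original vertices, whose neighbourhoods are nonempty and pairwise
  disjoint, so \<open>|M| \<le> |N(M)|\<close>.\<close>

section \<open>The gap of a graph without 4-cycles\<close>

definition nbhd :: "'a graph \<Rightarrow> 'a set \<Rightarrow> 'a set" where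
  "nbhd G X = {y. \<exists>x\<in>X. {x, y} \<in> edges G}"

definition indep :: "'a graph \<Rightarrow> 'a set \<Rightarrow> bool" where
  "indep G M \<longleftrightarrow> M \<subseteq> verts G \<and> M \<inter> nbhd G M = {}"

lemma edge_subset_verts:
  assumes "wf_graph G" "d \<in> edges G"
  shows "d \<subseteq> verts G"
proof -
  obtain i j where "i \<in> verts G" "j \<in> verts G" "d = {i, j}"
    using assms unfolding wf_graph_def by blast
  then show ?thesis by simp
qed

lemma nbhd_subset_verts:
  assumes "wf_graph G"
  shows "nbhd G X \<subseteq> verts G"
  using edge_subset_verts[OF assms] unfolding nbhd_def by blast

lemma nbhd_singleton: "y \<in> nbhd G {x} \<longleftrightarrow> {x, y} \<in> edges G"
  by (simp add: nbhd_def)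

lemma nbhd_commute: "y \<in> nbhd G {x} \<longleftrightarrow> x \<in> nbhd G {y}"
  by (simp add: nbhd_singleton insert_commute)

lemma finite_components: "finite C \<Longrightarrow> finite (components C)"
  by (simp add: components_def)

lemma snt_rank_le: "set_join_cover G C \<Longrightarrow> snt_rank G \<le> card (components C)"
  unfolding snt_rank_def by (rule Least_le) blast

lemma snt_rank_attained:
  assumes "wf_graph G"
  obtains C where "set_join_cover G C" "card (components C) = snt_rank G"
proof -
  have "\<exists>C. set_join_cover G C \<and> card (components C) = snt_rank G"
    unfolding snt_rank_def by (rule LeastI_ex) (use ex_set_join_cover[OF assms] in blast)
  then show thesis using that by auto
qed

text \<open>A cover is built that pays one singleton for each vertex outside \<open>M\<close> and
  one leaf set for each vertex of \<open>N(M)\<close>, hence uses at most |V| - |M| + |N(M)|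
  components.\<close>

lemma gap_ge_indep:
  assumes wf: "wf_graph G" and M: "indep G M"
  shows "int (card M) - int (card (nbhd G M)) \<le> gap G"
proof -
  \<comment> \<open>\<open>P\<close> covers the edges avoiding \<open>M\<close> one at a time;
    \<open>Q\<close> covers every edge meeting \<open>M\<close> by the full star at its end in
    \<open>N(M)\<close>.\<close>
  define P where "P = {({x}, {y}) | x y. x \<in> verts G - M \<and> y \<in> verts G - M \<and> {x, y} \<in> edges G}"
  define Q where "Q = (\<lambda>y. ({y}, nbhd G {y})) ` nbhd G M"
  have finV: "finite (verts G)" using wf by (simp add: wf_graph_def)
  have MV: "M \<subseteq> verts G" and disj: "M \<inter> nbhd G M = {}" using M by (auto simp: indep_def)
  have NV: "nbhd G M \<subseteq> verts G - M" using nbhd_subset_verts[OF wf, of M] disj by blast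
  have "P \<subseteq> (\<lambda>(x, y). ({x}, {y})) ` (verts G \<times> verts G)" unfolding P_def by auto
  then have finP: "finite P" by (rule finite_subset) (simp add: finV)
  have finN: "finite (nbhd G M)" using finite_subset[OF NV] finV by simp
  have nonempty: "nbhd G {y} \<noteq> {}" if y: "y \<in> nbhd G M" for y
  proof -
    obtain x where "{x, y} \<in> edges G" using y unfolding nbhd_def by blast
    then have "x \<in> nbhd G {y}" by (simp add: nbhd_singleton insert_commute)
    then show ?thesis by blast
  qed
  have "set_join_cover G (P \<union> Q)"
    unfolding set_join_cover_def
  proof (intro conjI)
    show "finite (P \<union> Q)" using finP finN by (simp add: Q_def)
    show "\<forall>(K, L)\<in>P \<union> Q. K \<noteq> {} \<and> L \<noteq> {} \<and> K \<subseteq> verts G \<and> L \<subseteq> verts G"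
      using NV nonempty nbhd_subset_verts[OF wf] unfolding P_def Q_def by blast
    show "edges G = (\<Union>(K, L)\<in>P \<union> Q. set_join_edges K L)"
    proof (intro equalityI subsetI)
      fix d assume d: "d \<in> edges G"
      then obtain i j where ij: "i \<in> verts G" "j \<in> verts G" "d = {i, j}"
        using wf unfolding wf_graph_def by blast
      have star: "d \<in> (\<Union>(K, L)\<in>P \<union> Q. set_join_edges K L)"
        if "x \<in> M" "d = {x, y}" for x y
      proof -
        have "y \<in> nbhd G M" using that d unfolding nbhd_def by blast
        then have "({y}, nbhd G {y}) \<in> P \<union> Q" unfolding Q_def by blast
        moreover have "x \<in> nbhd G {y}"
          using that d by (simp add: nbhd_singleton insert_commute)
        then have "d \<in> set_join_edges {y} (nbhd G {y})"
          unfolding set_join_edges_def that(2) insert_commute[of x y] by blast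
        ultimately show ?thesis by blast
      qed
      consider "i \<in> M" | "j \<in> M" | "i \<notin> M" "j \<notin> M" by blast
      then show "d \<in> (\<Union>(K, L)\<in>P \<union> Q. set_join_edges K L)"
      proof cases
        case 1 then show ?thesis using star ij(3) by blast
      next
        case 2 then show ?thesis using star[of j i] ij(3) by (simp add: insert_commute)
      next
        case 3
        then have "({i}, {j}) \<in> P" using ij d unfolding P_def by blast
        moreover have "d \<in> set_join_edges {i} {j}" using ij unfolding set_join_edges_def by blast
        ultimately show ?thesis by blast
      qed
    next
      fix d assume "d \<in> (\<Union>(K, L)\<in>P \<union> Q. set_join_edges K L)"
      then show "d \<in> edges G" unfolding P_def Q_def set_join_edges_def nbhd_def by auto
    qed
  qed
  then have rank: "snt_rank G \<le> card (components (P \<union> Q))" by (rule snt_rank_le)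
  \<comment> \<open>The centres of the stars in \<open>Q\<close> lie outside \<open>M\<close>, so
    their singletons are already among those counted; only the leaf sets are extra.\<close>
  have "components (P \<union> Q) \<subseteq> (\<lambda>x. {x}) ` (verts G - M) \<union> (\<lambda>y. nbhd G {y}) ` nbhd G M"
    using NV unfolding components_def P_def Q_def by auto
  then have "card (components (P \<union> Q)) \<le>
      card ((\<lambda>x. {x}) ` (verts G - M) \<union> (\<lambda>y. nbhd G {y}) ` nbhd G M)"
    by (rule card_mono[rotated]) (simp add: finV finN)
  also have "\<dots> \<le> card (verts G - M) + card (nbhd G M)"
    by (intro order_trans[OF card_Un_le] add_mono card_image_le finN finite_Diff finV)
  also have "card (verts G - M) = card (verts G) - card M"
    using MV finV by (simp add: card_Diff_subset finite_subset)
  finally show ?thesis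
    using rank card_mono[OF finV MV] unfolding gap_def by linarith
qed

text \<open>An optimal cover supplies \<open>M\<close>. Its components include the |V| - |M|
  singletons of \<open>S\<close> and the non-singletons \<open>A\<close>, and |N(M)| \<le> |A|
  because distinct vertices of \<open>N(M)\<close> are centres of stars with distinct leaf sets in
  \<open>A\<close>.\<close>

lemma gap_attained_indep:
  assumes wf: "wf_graph G"
    and no_C4: "\<And>x x' y y'. \<lbrakk>x \<noteq> x'; y \<in> nbhd G {x}; y \<in> nbhd G {x'};
      y' \<in> nbhd G {x}; y' \<in> nbhd G {x'}\<rbrakk> \<Longrightarrow> y = y'"
  obtains M where "indep G M" "gap G \<le> int (card M) - int (card (nbhd G M))"
proof -
  obtain C where C: "set_join_cover G C" and card_C: "card (components C) = snt_rank G"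
    using snt_rank_attained[OF wf] .
  define S where "S = {x \<in> verts G. {x} \<in> components C}"
  define M where "M = verts G - S"
  define A where "A = {P \<in> components C. \<forall>x. P \<noteq> {x}}"
  have finV: "finite (verts G)" using wf by (simp add: wf_graph_def)
  have finC: "finite (components C)" using C by (simp add: set_join_cover_def finite_components)
  have star: "y \<notin> M \<and> (\<exists>P\<in>A. P \<subseteq> nbhd G {y})" if x: "x \<in> M" and xy: "{x, y} \<in> edges G" for x y
  proof -
    obtain K L where KL: "(K, L) \<in> C" and d: "{x, y} \<in> set_join_edges K L"
      using C xy unfolding set_join_cover_def by blast
    have join: "{i, j} \<in> edges G" if "i \<in> K" "j \<in> L" for i j
      using C KL that unfolding set_join_cover_def set_join_edges_def by blast
    then have join': "{j, i} \<in> edges G" if "i \<in> K" "j \<in> L" for i j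
      using that by (simp add: insert_commute)
    have KLc: "K \<in> components C" "L \<in> components C"
      using KL unfolding components_def by force+
    have "x \<in> K \<and> y \<in> L \<or> y \<in> K \<and> x \<in> L"
      using d unfolding set_join_edges_def by (auto simp: doubleton_eq_iff)
    \<comment> \<open>Set-joins are symmetric, so let \<open>P\<close> be the side containing
      \<open>x\<close>. As \<open>{x}\<close> is no component, \<open>P\<close> has a second element
      \<open>x'\<close>; every element of \<open>Q\<close> is a common neighbour of \<open>x\<close>
      and \<open>x'\<close>, which forces \<open>Q = {y}\<close>.\<close>
    then obtain P Q where PQ: "P \<in> components C" "Q \<in> components C" "x \<in> P" "y \<in> Q"
      and nb: "\<And>i j. i \<in> P \<Longrightarrow> j \<in> Q \<Longrightarrow> j \<in> nbhd G {i}"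
    proof
      assume "x \<in> K \<and> y \<in> L"
      then show thesis using join KLc by (intro that[of K L]) (simp_all add: nbhd_singleton)
    next
      assume "y \<in> K \<and> x \<in> L"
      then show thesis
        using join' KLc by (intro that[of L K]) (simp_all add: nbhd_singleton)
    qed
    have "P \<noteq> {x}" using x PQ(1) unfolding M_def S_def by blast
    then obtain x' where x': "x' \<in> P" "x' \<noteq> x" using PQ(3) by blast
    have "y' = y" if "y' \<in> Q" for y'
      by (rule no_C4[OF x'(2)]) (use nb x'(1) PQ(3,4) that in blast)+
    then have Q: "Q = {y}" using PQ(4) by blast
    have "P \<in> A" using x' PQ(1,3) unfolding A_def by blast
    moreover have "P \<subseteq> nbhd G {y}" using nb[of _ y] PQ(4) nbhd_commute[of y G] by blast
    moreover have "y \<notin> M" using Q PQ(2) unfolding M_def S_def by blast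
    ultimately show ?thesis by blast
  qed
  have indep: "indep G M"
    using star unfolding indep_def nbhd_def by (auto simp: M_def)
  have "\<forall>y\<in>nbhd G M. \<exists>P. P \<in> A \<and> P \<subseteq> nbhd G {y}"
    using star unfolding nbhd_def by blast
  then obtain p where p: "\<And>y. y \<in> nbhd G M \<Longrightarrow> p y \<in> A \<and> p y \<subseteq> nbhd G {y}"
    by metis
  have "inj_on p (nbhd G M)"
  proof (rule inj_onI)
    fix y y' assume y: "y \<in> nbhd G M" "y' \<in> nbhd G M" "p y = p y'"
    \<comment> \<open>\<open>A\<close> excludes only singletons; nonemptiness comes from the
      definition of a cover. Together they give two distinct leaves, and both \<open>y\<close> and
      \<open>y'\<close> are adjacent to each of them.\<close>
    have "p y \<noteq> {}" using p[OF y(1)] C unfolding A_def components_def set_join_cover_def by force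
    then obtain a b where ab: "a \<in> p y" "b \<in> p y" "a \<noteq> b"
      using p[OF y(1)] unfolding A_def by blast
    have "y \<in> nbhd G {i} \<and> y' \<in> nbhd G {i}" if "i \<in> p y" for i
      using p[OF y(1)] p[OF y(2)] y(3) that nbhd_commute[of i G] by auto
    then show "y = y'" using no_C4[OF ab(3)] ab(1,2) by simp
  qed
  moreover have "p ` nbhd G M \<subseteq> A" using p by blast
  moreover have finA: "finite A" using finC by (simp add: A_def)
  ultimately have NA: "card (nbhd G M) \<le> card A" by (rule card_inj_on_le)
  have "card ((\<lambda>x. {x}) ` S \<union> A) = card S + card A"
    using finV finA by (subst card_Un_disjoint) (auto simp: S_def A_def card_image)
  moreover have "card ((\<lambda>x. {x}) ` S \<union> A) \<le> card (components C)"
    by (rule card_mono[OF finC]) (auto simp: S_def A_def)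
  moreover have "card M + card S = card (verts G)"
  proof -
    have "S \<subseteq> verts G" by (auto simp: S_def)
    then show ?thesis
      using finV card_mono[of "verts G" S] by (simp add: M_def card_Diff_subset finite_subset)
  qed
  ultimately have "gap G \<le> int (card M) - int (card (nbhd G M))"
    using NA card_C unfolding gap_def by linarith
  with indep show thesis by (rule that)
qed

section \<open>The graph \<open>\<zeta>(\<Gamma>)\<close> for weights 0\<close>

text \<open>These two conditions pass to vertex-deleted multigraphs, so every fact below can be
  reused for \<open>delete_vertex \<Gamma> v\<close>. Positive degrees are not inherited and enter
  only later.\<close>

locale zero_weighted =
  fixes \<Gamma> :: "('v, 'e) multigraph"
  assumes wf: "wf_multigraph \<Gamma>"
    and weight0: "\<And>e. e \<in> medges \<Gamma> \<Longrightarrow> weight \<Gamma> e = 0"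
begin

definition src :: "'e \<Rightarrow> 'v" where "src e = fst (orient (ends \<Gamma> e))"
definition tgt :: "'e \<Rightarrow> 'v" where "tgt e = snd (orient (ends \<Gamma> e))"

lemma ends_eq: "e \<in> medges \<Gamma> \<Longrightarrow> ends \<Gamma> e = {src e, tgt e}"
  using orient_ends[OF wf] by (simp add: src_def tgt_def)

lemma zpath_eq: "e \<in> medges \<Gamma> \<Longrightarrow> zpath \<Gamma> e = [Orig (src e), Sub e 1, Sub e 2, Orig (tgt e)]"
  by (simp add: zpath_def num_new_def weight0 src_def tgt_def numeral_2_eq_2)

lemma mem_verts_zeta [simp]:
  "Orig u \<in> verts (zeta \<Gamma>) \<longleftrightarrow> u \<in> mverts \<Gamma>"
  "Sub e i \<in> verts (zeta \<Gamma>) \<longleftrightarrow> e \<in> medges \<Gamma> \<and> (i = 1 \<or> i = 2)"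
  by (auto simp: zeta_def num_new_def weight0)

lemma edges_zeta:
  "edges (zeta \<Gamma>) = (\<Union>e\<in>medges \<Gamma>.
     {{Orig (src e), Sub e 1}, {Sub e 1, Sub e 2}, {Sub e 2, Orig (tgt e)}})"
proof -
  have "{{zpath \<Gamma> e ! i, zpath \<Gamma> e ! Suc i} | i. Suc i < length (zpath \<Gamma> e)} =
      {{Orig (src e), Sub e 1}, {Sub e 1, Sub e 2}, {Sub e 2, Orig (tgt e)}}"
    if "e \<in> medges \<Gamma>" for e
  proof -
    have "{i. Suc i < length (zpath \<Gamma> e)} = {0, 1, 2}"
      using that by (auto simp: zpath_eq)
    then have "{{zpath \<Gamma> e ! i, zpath \<Gamma> e ! Suc i} | i. Suc i < length (zpath \<Gamma> e)} =
        (\<lambda>i. {zpath \<Gamma> e ! i, zpath \<Gamma> e ! Suc i}) ` {0, 1, 2}"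
      by blast
    also have "\<dots> = {{Orig (src e), Sub e 1}, {Sub e 1, Sub e 2}, {Sub e 2, Orig (tgt e)}}"
      using that by (simp add: zpath_eq numeral_2_eq_2)
    finally show ?thesis .
  qed
  moreover have "edges (zeta \<Gamma>) = (\<Union>e\<in>medges \<Gamma>.
      {{zpath \<Gamma> e ! i, zpath \<Gamma> e ! Suc i} | i. Suc i < length (zpath \<Gamma> e)})"
    unfolding zeta_def by auto
  ultimately show ?thesis by simp
qed

lemma adj_zeta [simp]:
  "{Orig u, Orig v} \<notin> edges (zeta \<Gamma>)"
  "{Orig u, Sub e i} \<in> edges (zeta \<Gamma>) \<longleftrightarrow>
     e \<in> medges \<Gamma> \<and> (i = 1 \<and> u = src e \<or> i = 2 \<and> u = tgt e)"
  "{Sub e i, Orig u} \<in> edges (zeta \<Gamma>) \<longleftrightarrow>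
     e \<in> medges \<Gamma> \<and> (i = 1 \<and> u = src e \<or> i = 2 \<and> u = tgt e)"
  "{Sub e i, Sub f j} \<in> edges (zeta \<Gamma>) \<longleftrightarrow>
     e \<in> medges \<Gamma> \<and> f = e \<and> (i = 1 \<and> j = 2 \<or> i = 2 \<and> j = 1)"
  by (simp_all add: edges_zeta doubleton_eq_iff) blast+

text \<open>Each edge or loop becomes a path of length 3, so the length of every cycle of
  \<open>zeta \<Gamma>\<close> is a multiple of 3 and there is no 4-cycle.\<close>

lemma no_C4_zeta:
  assumes "x \<noteq> x'" "y \<in> nbhd (zeta \<Gamma>) {x}" "y \<in> nbhd (zeta \<Gamma>) {x'}"
    "y' \<in> nbhd (zeta \<Gamma>) {x}" "y' \<in> nbhd (zeta \<Gamma>) {x'}"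
  shows "y = y'"
  using assms unfolding nbhd_singleton
  by (cases x; cases x'; cases y; cases y'; simp; elim conjE disjE; simp)

lemmas gap_star_ge = gap_ge_indep[OF wf_graph_zeta[OF wf], folded gap_star_def]

lemmas gap_star_attained =
  gap_attained_indep[OF wf_graph_zeta[OF wf] no_C4_zeta, folded gap_star_def]

lemma finite_verts_zeta: "finite (verts (zeta \<Gamma>))"
  using wf_graph_zeta[OF wf] by (simp add: wf_graph_def)

lemma finite_nbhd_zeta: "finite (nbhd (zeta \<Gamma>) X)"
  using nbhd_subset_verts[OF wf_graph_zeta[OF wf]] finite_verts_zeta by (rule finite_subset)

section \<open>Vertex deletion and its effect on \<open>zeta\<close> and on independent sets\<close>

lemma delete_vertex_zero_weighted: "zero_weighted (delete_vertex \<Gamma> v)"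
proof
  show "wf_multigraph (delete_vertex \<Gamma> v)"
    unfolding wf_multigraph_def
  proof (intro conjI ballI)
    fix e assume "e \<in> medges (delete_vertex \<Gamma> v)"
    then have e: "e \<in> medges \<Gamma>" "v \<notin> ends \<Gamma> e" by (auto simp: delete_vertex_def)
    have "\<exists>u\<in>mverts \<Gamma>. \<exists>w\<in>mverts \<Gamma>. ends \<Gamma> e = {u, w}"
      using wf e(1) by (simp add: wf_multigraph_def)
    then obtain u w where uw: "u \<in> mverts \<Gamma>" "w \<in> mverts \<Gamma>" "ends \<Gamma> e = {u, w}"
      by (elim bexE)
    then have "u \<noteq> v" "w \<noteq> v" using e(2) by auto
    with uw show "\<exists>u\<in>mverts (delete_vertex \<Gamma> v). \<exists>w\<in>mverts (delete_vertex \<Gamma> v).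
        ends (delete_vertex \<Gamma> v) e = {u, w}"
      by (intro bexI[of _ u] bexI[of _ w]) (simp_all add: delete_vertex_def)
    show "weight (delete_vertex \<Gamma> v) e \<in> {0, 1}"
      using e(1) by (simp add: delete_vertex_def weight0)
  qed (use wf in \<open>simp_all add: wf_multigraph_def delete_vertex_def\<close>)
qed (simp add: delete_vertex_def weight0)

text \<open>\<open>orient\<close> depends only on the set of ends, which deletion leaves unchanged.
  Thus \<open>zeta (delete_vertex \<Gamma> v)\<close> is literally the induced subgraph of
  \<open>zeta \<Gamma>\<close> without \<open>Orig v\<close> and the new vertices on edges at
  \<open>v\<close>, not just an isomorphic copy.\<close>

lemma src_delete [simp]: "zero_weighted.src (delete_vertex \<Gamma> v) e = src e"
  and tgt_delete [simp]: "zero_weighted.tgt (delete_vertex \<Gamma> v) e = tgt e"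
  using delete_vertex_zero_weighted
  by (simp_all add: zero_weighted.src_def zero_weighted.tgt_def src_def tgt_def delete_vertex_def)

lemma medges_delete [simp]:
  "e \<in> medges (delete_vertex \<Gamma> v) \<longleftrightarrow> e \<in> medges \<Gamma> \<and> v \<noteq> src e \<and> v \<noteq> tgt e"
  using ends_eq[of e] by (auto simp: delete_vertex_def)

lemma mverts_delete [simp]: "mverts (delete_vertex \<Gamma> v) = mverts \<Gamma> - {v}"
  by (simp add: delete_vertex_def)

lemmas zeta_delete_simps [simp] =
  zero_weighted.mem_verts_zeta[OF delete_vertex_zero_weighted]
  zero_weighted.adj_zeta[OF delete_vertex_zero_weighted]

end

text \<open>Swaps the two new vertices on the path of an edge; the value on \<open>Orig u\<close> is
  a filler.\<close>

fun mate :: "('v, 'e) zvertex \<Rightarrow> ('v, 'e) zvertex" where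
  "mate (Orig u) = Orig u"
| "mate (Sub e i) = Sub e (if i = 1 then 2 else 1)"

context zero_weighted
begin

text \<open>Adding \<open>B\<close> to \<open>M\<close> gains |B| vertices, and the new neighbours
  are at most the |B| mates and \<open>Orig v\<close>, a net loss of at most 1.\<close>

lemma gap_star_delete_le: "gap_star (delete_vertex \<Gamma> v) - 1 \<le> gap_star \<Gamma>"
proof -
  interpret D: zero_weighted "delete_vertex \<Gamma> v" by (rule delete_vertex_zero_weighted)
  let ?H = "zeta \<Gamma>" and ?H' = "zeta (delete_vertex \<Gamma> v)"
  obtain M where M: "indep ?H' M"
    and gap: "gap_star (delete_vertex \<Gamma> v) \<le> int (card M) - int (card (nbhd ?H' M))"
    using D.gap_star_attained .
  \<comment> \<open>Loops at \<open>v\<close> are left out: their two new vertices are adjacent to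
    each other as well as to \<open>v\<close>, so taking both would destroy independence.\<close>
  define B :: "('v, 'e) zvertex set" where "B = {Sub e i | e i. e \<in> medges \<Gamma> \<and> src e \<noteq> tgt e \<and>
    (i = 1 \<and> src e = v \<or> i = 2 \<and> tgt e = v)}"
  have MV: "M \<subseteq> verts ?H'" using M by (simp add: indep_def)
  have finB: "finite B"
    using finite_verts_zeta by (rule rev_finite_subset) (auto simp: B_def)
  have finM: "finite M" using MV D.finite_verts_zeta by (rule finite_subset)
  have MB: "M \<inter> B = {}"
    using MV by (auto simp: B_def)
  \<comment> \<open>An edge at \<open>M\<close> missing from the smaller graph joins some
    \<open>Orig u\<close>, \<open>u \<noteq> v\<close>, to a new vertex on an edge between
    \<open>u\<close> and \<open>v\<close>. The other new vertex on that edge is next to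
    \<open>v\<close>, hence in \<open>B\<close>, so this neighbour is a mate already paid
    for.\<close>
  have edge_cases: "{x, y} \<in> edges ?H' \<or> y \<in> mate ` B" if "x \<in> M" "{x, y} \<in> edges ?H" for x y
  proof (cases x)
    case (Orig u)
    then have u: "u \<noteq> v" using that(1) MV by auto
    show ?thesis
    proof (cases y)
      case y: (Sub e i)
      show ?thesis
      proof (cases "v = src e \<or> v = tgt e")
        case True
        then have "Sub e (if i = 1 then 2 else 1) \<in> B"
          using that(2) Orig u y by (auto simp: B_def)
        then have "mate (Sub e (if i = 1 then 2 else 1)) \<in> mate ` B" by (rule imageI)
        moreover have "mate (Sub e (if i = 1 then 2 else 1)) = y"
          using that(2) Orig y by auto
        ultimately show ?thesis by simp
      qed (use that(2) Orig y in auto)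
    qed (use that(2) Orig in simp)
  next
    case (Sub e i)
    then show ?thesis using that MV by (cases y) auto
  qed
  have B_edge: "y = Orig v \<or> y \<in> mate ` B" if "x \<in> B" "{x, y} \<in> edges ?H" for x y
  proof -
    obtain e i where x: "x = Sub e i" and e: "e \<in> medges \<Gamma>" "src e \<noteq> tgt e"
      "i = 1 \<and> src e = v \<or> i = 2 \<and> tgt e = v"
      using \<open>x \<in> B\<close> unfolding B_def by blast
    then have "y = Orig v \<or> y = mate x"
      using that(2) by (cases y) auto
    then show ?thesis using that(1) by blast
  qed
  have mate_B: "mate ` B \<inter> B = {}" "mate ` B \<inter> M = {}"
    using MV by (auto simp: B_def)
  have vMB: "Orig v \<notin> M \<union> B"
    using MV by (auto simp: B_def)
  have sub: "nbhd ?H (M \<union> B) \<subseteq> nbhd ?H' M \<union> insert (Orig v) (mate ` B)"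
  proof
    fix y assume "y \<in> nbhd ?H (M \<union> B)"
    then obtain x where "x \<in> M \<union> B" "{x, y} \<in> edges ?H" by (auto simp: nbhd_def)
    then show "y \<in> nbhd ?H' M \<union> insert (Orig v) (mate ` B)"
      using edge_cases[of x y] B_edge[of x y] by (auto simp: nbhd_def)
  qed
  have "nbhd ?H' M \<inter> M = {}" using M by (auto simp: indep_def)
  moreover have "nbhd ?H' M \<inter> B = {}"
    using nbhd_subset_verts[OF wf_graph_zeta[OF D.wf], of M] by (auto simp: B_def)
  moreover have "M \<union> B \<subseteq> verts ?H"
  proof
    fix x assume "x \<in> M \<union> B"
    then show "x \<in> verts ?H" using MV by (cases x) (auto simp: B_def)
  qed
  ultimately have "indep ?H (M \<union> B)"
    unfolding indep_def using sub mate_B vMB by blast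
  then have "int (card (M \<union> B)) - int (card (nbhd ?H (M \<union> B))) \<le> gap_star \<Gamma>"
    by (rule gap_star_ge)
  moreover have "card (M \<union> B) = card M + card B"
    using finM finB MB by (rule card_Un_disjoint)
  moreover have "card (nbhd ?H (M \<union> B)) \<le> card (nbhd ?H' M \<union> insert (Orig v) (mate ` B))"
    using sub by (rule card_mono[rotated]) (simp add: D.finite_nbhd_zeta finB)
  moreover have "\<dots> \<le> card (nbhd ?H' M) + Suc (card B)"
    using card_Un_le[of "nbhd ?H' M" "insert (Orig v) (mate ` B)"] card_insert_le_m1
      card_image_le[OF finB, of mate] card_insert_if[of "mate ` B" "Orig v"] finB
    by (auto split: if_splits)
  ultimately show ?thesis using gap by linarith
qed

text \<open>The part of \<open>M\<close> lost by restriction is compensated by its mates, which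
  leave the neighbourhood; \<open>Orig v\<close> leaves it too, and this is the gain of 1.\<close>

lemma gap_star_le_delete:
  assumes M: "indep (zeta \<Gamma>) M" and vN: "Orig v \<in> nbhd (zeta \<Gamma>) M"
  shows "int (card M) - int (card (nbhd (zeta \<Gamma>) M)) \<le> gap_star (delete_vertex \<Gamma> v) - 1"
proof -
  interpret D: zero_weighted "delete_vertex \<Gamma> v" by (rule delete_vertex_zero_weighted)
  let ?H = "zeta \<Gamma>" and ?H' = "zeta (delete_vertex \<Gamma> v)"
  \<comment> \<open>\<open>R\<close> and \<open>Orig v\<close> are exactly what deletion removes;
    loops at \<open>v\<close> are included here, unlike in \<open>B\<close> above.\<close>
  define R :: "('v, 'e) zvertex set" where "R = {Sub e i | e i. e \<in> medges \<Gamma> \<and> (v = src e \<or> v = tgt e) \<and> (i = 1 \<or> i = 2)}"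
  define M' where "M' = M \<inter> verts ?H'"
  have MV: "M \<subseteq> verts ?H" and disj: "M \<inter> nbhd ?H M = {}" using M by (auto simp: indep_def)
  have finM: "finite M" using MV finite_verts_zeta by (rule finite_subset)
  have M_eq: "M = M' \<union> (M \<inter> R)"
  proof
    show "M \<subseteq> M' \<union> (M \<inter> R)"
    proof
      fix x assume x: "x \<in> M"
      \<comment> \<open>Independence keeps \<open>Orig v\<close> out of \<open>M\<close>, since it
        lies in the neighbourhood of \<open>M\<close>.\<close>
      then have "x \<noteq> Orig v" "x \<in> verts ?H" using vN disj MV by auto
      then show "x \<in> M' \<union> (M \<inter> R)"
        using x by (cases x) (auto simp: M'_def R_def)
    qed
  qed (auto simp: M'_def)
  have "M' \<inter> (M \<inter> R) = {}" by (auto simp: M'_def R_def)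
  then have cardM: "card M = card M' + card (M \<inter> R)"
    using M_eq finM by (metis card_Un_disjoint finite_Un)
  have edge_sub: "{x, y} \<in> edges ?H" if "{x, y} \<in> edges ?H'" for x y
    using that by (cases x; cases y) auto
  have N_sub: "nbhd ?H' M' \<subseteq> nbhd ?H M"
    using edge_sub by (auto simp: nbhd_def M'_def)
  have NV: "nbhd ?H' M' \<subseteq> verts ?H'" by (rule nbhd_subset_verts[OF wf_graph_zeta[OF D.wf]])
  have "indep ?H' M'"
    using disj N_sub by (auto simp: indep_def M'_def)
  then have le: "int (card M') - int (card (nbhd ?H' M')) \<le> gap_star (delete_vertex \<Gamma> v)"
    by (rule D.gap_star_ge)
  have "inj_on mate (M \<inter> R)"
    by (rule inj_onI) (auto simp: R_def split: if_splits)
  moreover have "mate ` (M \<inter> R) \<subseteq> nbhd ?H M \<inter> R"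
    by (force simp: R_def nbhd_def)
  ultimately have cardR: "card (M \<inter> R) \<le> card (nbhd ?H M \<inter> R)"
    by (rule card_inj_on_le) (simp add: finite_nbhd_zeta)
  \<comment> \<open>The neighbourhood of \<open>M\<close> contains three disjoint pieces: the
    neighbourhood of \<open>M'\<close> in the smaller graph, its own part in \<open>R\<close>, and
    \<open>Orig v\<close>.\<close>
  have "card (nbhd ?H' M' \<union> insert (Orig v) (nbhd ?H M \<inter> R)) \<le> card (nbhd ?H M)"
    using N_sub vN by (intro card_mono finite_nbhd_zeta) auto
  moreover have "card (nbhd ?H' M' \<union> insert (Orig v) (nbhd ?H M \<inter> R)) =
      card (nbhd ?H' M') + card (insert (Orig v) (nbhd ?H M \<inter> R))"
    using NV by (intro card_Un_disjoint) (auto simp: D.finite_nbhd_zeta finite_nbhd_zeta R_def)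
  moreover have "card (insert (Orig v) (nbhd ?H M \<inter> R)) = Suc (card (nbhd ?H M \<inter> R))"
    by (rule card_insert_disjoint) (auto simp: finite_nbhd_zeta R_def)
  ultimately show ?thesis using cardM cardR le by linarith
qed

text \<open>A new vertex in \<open>M\<close> would put an original vertex into the neighbourhood.
  Each original vertex has an incident edge, and a new vertex has only one original neighbour, so
  choosing a new neighbour for each element of \<open>M\<close> is injective.\<close>

lemma card_le_nbhd:
  assumes deg: "\<And>u. u \<in> mverts \<Gamma> \<Longrightarrow> mdegree \<Gamma> u \<noteq> 0"
    and M: "M \<subseteq> verts (zeta \<Gamma>)" and noOrig: "\<And>u. Orig u \<notin> nbhd (zeta \<Gamma>) M"
  shows "card M \<le> card (nbhd (zeta \<Gamma>) M)"
proof -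
  have "\<exists>y. {x, y} \<in> edges (zeta \<Gamma>) \<and> (\<exists>u e i. x = Orig u \<and> y = Sub e i)" if x: "x \<in> M" for x
  proof (cases x)
    case (Orig u)
    then have "mdegree \<Gamma> u \<noteq> 0" using deg x M by auto
    then have "{e \<in> medges \<Gamma>. u \<in> ends \<Gamma> e} \<noteq> {}"
      unfolding mdegree_def by (auto simp: card_eq_0_iff)
    then obtain e where e: "e \<in> medges \<Gamma>" "u \<in> ends \<Gamma> e" by blast
    then have "{x, Sub e (if u = src e then 1 else 2)} \<in> edges (zeta \<Gamma>)"
      using ends_eq[OF e(1)] Orig by auto
    then show ?thesis using Orig by blast
  next
    case (Sub e i)
    then have "Orig (if i = 1 then src e else tgt e) \<in> nbhd (zeta \<Gamma>) M"
      using x M by (auto simp: nbhd_def intro!: bexI[of _ x])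
    then show ?thesis using noOrig by blast
  qed
  then obtain f where f: "\<And>x. x \<in> M \<Longrightarrow> {x, f x} \<in> edges (zeta \<Gamma>)"
    and f': "\<And>x. x \<in> M \<Longrightarrow> \<exists>u e i. x = Orig u \<and> f x = Sub e i"
    by metis
  have "inj_on f M"
  proof (rule inj_onI)
    fix x y assume xy: "x \<in> M" "y \<in> M" "f x = f y"
    obtain u u' e i where "x = Orig u" "y = Orig u'" "f x = Sub e i" "f y = Sub e i"
      using f'[OF xy(1)] f'[OF xy(2)] xy(3) by auto
    then show "x = y" using f[OF xy(1)] f[OF xy(2)] by auto
  qed
  moreover have "f ` M \<subseteq> nbhd (zeta \<Gamma>) M" using f by (auto simp: nbhd_def)
  ultimately show ?thesis by (rule card_inj_on_le) (rule finite_nbhd_zeta)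
qed

end

section \<open>The deletion formula for \<open>gap_star\<close>\<close>

theorem theorem7p6:
  fixes \<Gamma> :: "('v, 'e) multigraph"
  assumes "wf_multigraph \<Gamma>"
    and "\<forall>e\<in>medges \<Gamma>. weight \<Gamma> e = 0"
    and "card (mverts \<Gamma>) \<ge> 2"
    and "\<forall>v\<in>mverts \<Gamma>. mdegree \<Gamma> v \<noteq> 0"
  shows "gap_star \<Gamma> =
    max 0 (Max ((\<lambda>v. gap_star (delete_vertex \<Gamma> v) - 1) ` mverts \<Gamma>))"
proof -
  interpret zero_weighted \<Gamma> by unfold_locales (use assms in auto)
  let ?g = "\<lambda>v. gap_star (delete_vertex \<Gamma> v) - 1"
  have fin: "finite (mverts \<Gamma>)" and ne: "mverts \<Gamma> \<noteq> {}" using assms(3) by (auto intro: card_ge_0_finite)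
  show ?thesis
  proof (rule antisym)
    obtain M where M: "indep (zeta \<Gamma>) M"
      and gap: "gap_star \<Gamma> \<le> int (card M) - int (card (nbhd (zeta \<Gamma>) M))"
      using gap_star_attained .
    show "gap_star \<Gamma> \<le> max 0 (Max (?g ` mverts \<Gamma>))"
    proof (cases "\<exists>v. Orig v \<in> nbhd (zeta \<Gamma>) M")
      case True
      then obtain v where vN: "Orig v \<in> nbhd (zeta \<Gamma>) M" by blast
      then have v: "v \<in> mverts \<Gamma>" using nbhd_subset_verts[OF wf_graph_zeta[OF wf], of M] by auto
      have "gap_star \<Gamma> \<le> ?g v" using gap gap_star_le_delete[OF M vN] by linarith
      also have "\<dots> \<le> Max (?g ` mverts \<Gamma>)" using fin v by simp
      finally show ?thesis by simp
    next
      case False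
      then have "card M \<le> card (nbhd (zeta \<Gamma>) M)"
        using card_le_nbhd assms(4) M unfolding indep_def by blast
      then show ?thesis using gap by simp
    qed
    \<comment> \<open>The empty independent set has difference 0.\<close>
    have "0 \<le> gap_star \<Gamma>"
      using gap_star_ge[of "{}"] by (simp add: indep_def nbhd_def)
    moreover have "Max (?g ` mverts \<Gamma>) \<le> gap_star \<Gamma>"
      using fin ne gap_star_delete_le by (intro Max.boundedI) auto
    ultimately show "max 0 (Max (?g ` mverts \<Gamma>)) \<le> gap_star \<Gamma>" by simp
  qed
qed

end
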